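(* Let $m\ge 3$ and $\theta_c(\mathrm{TR},m)=\frac{m-3}{5m-3}$. For $\theta\in(0,1]$: (i) if $\theta<\theta_c(\mathrm{TR},m)$ then $\lim_{n\to\infty}\rho(\mathrm{TR},m,n,\theta)=1$; (ii) if $\theta>\theta_c(\mathrm{TR},m)$ then $\lim_{n\to\infty}\rho(\mathrm{TR},m,n,\theta)=0$.
   Context: A ranking is a strict total order on the candidates. A discrete profile $P$ consists of candidates, $n$ voters and a ranking $P_v$ per voter. For a set $K$ of candidates, $P_K$ is the profile obtained by restricting each ranking to $K$. Plurality score $s_{\mathrm{Plu}}(c,P)$: number (weight) of voters ranking $c$ first. Two-Round System ($\mathrm{TR}$): the two candidates with the highest Plurality scores in $P$ form a set $K$; the winner is the candidate of $K$ with the higher Plurality score in $P_K$; ties broken by an arbitrary fixed tie-breaking rule (the result holds for any such rule). CM: a rule $f$ is coalitionally manipulable in a discrete profile $P$ if there is a discrete $Q$ with the same candidates and voters such that $f(Q)\ne f(P)$ and every voter $v$ with $Q_v\ne P_v$ prefers $f(Q)$ to $f(P)$ according to $P_v$. Perturbed Culture ($m,n\ge1$, $\theta\in(0,1]$): random discrete profile with candidates $\{1,\dots,m\}$, voters $\{1,\dots,n\}$, each voter independently having ranking $1\succ 2\succ\cdots\succ m$ with probability $\theta$ and a uniformly random ranking with probability $1-\theta$. $\rho(f,m,n,\theta)$ is the probability that $f$ is CM in the random profile. *)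

theory Defs
  imports Complex_Main
begin

text \<open>Candidates are 1,...,m. A ranking is a list of all candidates without repetition,
  best candidate first. A discrete profile with n voters is a list of n rankings
  (voter v, for v < n, has ranking P ! v).\<close>

definition rankings :: "nat \<Rightarrow> nat list set" where
  "rankings m = {r. distinct r \<and> set r = {1..m}}"

definition profiles :: "nat \<Rightarrow> nat \<Rightarrow> nat list list set" where
  "profiles m n = {P. length P = n \<and> set P \<subseteq> rankings m}"

definition prefers :: "nat list \<Rightarrow> nat \<Rightarrow> nat \<Rightarrow> bool" where
  "prefers r a b \<longleftrightarrow> (\<exists>i j. i < j \<and> j < length r \<and> r ! i = a \<and> r ! j = b)"

definition plu_score :: "nat list list \<Rightarrow> nat \<Rightarrow> nat" where
  "plu_score P c = card {v. v < length P \<and> hd (P ! v) = c}"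

definition plu_score_restr :: "nat list list \<Rightarrow> nat set \<Rightarrow> nat \<Rightarrow> nat" where
  "plu_score_restr P K c = card {v. v < length P \<and> (\<forall>d\<in>K - {c}. prefers (P ! v) c d)}"

text \<open>Two-Round System with a fixed tie-breaking rule tb: tb picks, from any nonempty
  set S of tied candidates, one element of S.\<close>
definition TR :: "(nat set \<Rightarrow> nat) \<Rightarrow> nat \<Rightarrow> nat list list \<Rightarrow> nat" where
  "TR tb m P =
    (let A = {1..m};
         f1 = tb {c \<in> A. \<forall>d\<in>A. plu_score P d \<le> plu_score P c};
         B = A - {f1};
         f2 = tb {c \<in> B. \<forall>d\<in>B. plu_score P d \<le> plu_score P c};
         K = {f1, f2}
     in tb {c \<in> K. \<forall>d\<in>K. plu_score_restr P K d \<le> plu_score_restr P K c})"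

definition TR_CM :: "(nat set \<Rightarrow> nat) \<Rightarrow> nat \<Rightarrow> nat list list \<Rightarrow> bool" where
  "TR_CM tb m P \<longleftrightarrow>
    (\<exists>Q \<in> profiles m (length P). TR tb m Q \<noteq> TR tb m P \<and>
       (\<forall>v < length P. Q ! v \<noteq> P ! v \<longrightarrow> prefers (P ! v) (TR tb m Q) (TR tb m P)))"

definition pc_prob :: "nat \<Rightarrow> real \<Rightarrow> nat list \<Rightarrow> real" where
  "pc_prob m \<theta> r = (if r = [1..<m+1] then \<theta> else 0) + (1 - \<theta>) / fact m"

definition rho_TR :: "(nat set \<Rightarrow> nat) \<Rightarrow> nat \<Rightarrow> nat \<Rightarrow> real \<Rightarrow> real" where
  "rho_TR tb m n \<theta> =
    (\<Sum>P \<in> profiles m n. if TR_CM tb m P then (\<Prod>v<n. pc_prob m \<theta> (P ! v)) else 0)"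

end

theory Submission
  imports Defs "HOL-Combinatorics.Multiset_Permutations"
begin

text \<open>By the weak law of large numbers, with probability tending to 1 every set of rankings has a
  frequency close to its probability. In such a profile candidate 1 wins, and beats every c in a duel,
  so a coalition favouring c must keep 1 out of the second round: the supporters of c against 1, a
  fraction (1 - \<theta>)/2, have to lift both c and some d to the score \<theta> + (1 - \<theta>)/m of 1. Among
  the remaining voters c has no first place and d has (1 - \<theta>)/(2m) of them, so this is
  possible only if (1 - \<theta>)/2 + (1 - \<theta>)/(2m) \<ge> 2(\<theta> + (1 - \<theta>)/m), that is,
  \<theta> \<le> (m - 3)/(5m - 3). Below the threshold, c = 2 and d = 3 succeed, because 2 then also
  beats 3 in the second round.\<close>

section \<open>A weak law of large numbers for random lists\<close>

definition count_sat :: "('a \<Rightarrow> bool) \<Rightarrow> 'a list \<Rightarrow> nat" where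
  "count_sat \<phi> xs = card {v. v < length xs \<and> \<phi> (xs ! v)}"

lemma count_sat_filter: "count_sat \<phi> xs = length (filter \<phi> xs)"
  by (simp add: count_sat_def length_filter_conv_card)

lemma sum_lists_Suc:
  fixes f :: "'a list \<Rightarrow> real"
  assumes "finite A"
  shows "(\<Sum>xs | set xs \<subseteq> A \<and> length xs = Suc n. f xs) =
    (\<Sum>x\<in>A. \<Sum>xs | set xs \<subseteq> A \<and> length xs = n. f (x # xs))"
proof -
  let ?L = "{xs. set xs \<subseteq> A \<and> length xs = n}"
  have "(\<Sum>xs | set xs \<subseteq> A \<and> length xs = Suc n. f xs) = (\<Sum>(xs, x)\<in>?L \<times> A. f (x # xs))"
    unfolding lists_length_Suc_eq by (subst sum.reindex) (auto simp: inj_on_def intro!: sum.cong)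
  also have "\<dots> = (\<Sum>xs\<in>?L. \<Sum>x\<in>A. f (x # xs))"
    by (simp add: sum.cartesian_product)
  also have "\<dots> = (\<Sum>x\<in>A. \<Sum>xs\<in>?L. f (x # xs))"
    by (rule sum.swap)
  finally show ?thesis .
qed

text \<open>Under the product weight \<open>W\<close>, \<open>Y\<close> is a sum of independent
  copies of the centred indicator of \<open>S\<close>. Peeling off the first entry, the cross term
  of the square is a product of two means that vanish, so the variances add up. The second moment
  needs the other two claims in its induction step, hence the joint statement.\<close>

lemma moments_of_count:
  fixes w :: "'a \<Rightarrow> real"
  assumes fin: "finite A" and w1: "sum w A = 1" and S: "S \<subseteq> A"
  defines "p \<equiv> sum w S"
  defines "Y \<equiv> \<lambda>xs. real (count_sat (\<lambda>x. x \<in> S) xs) - real (length xs) * p"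
  defines "W \<equiv> \<lambda>xs. prod_list (map w xs)"
  defines "L \<equiv> \<lambda>n. {xs. set xs \<subseteq> A \<and> length xs = n}"
  shows "sum W (L n) = 1" "(\<Sum>xs\<in>L n. W xs * Y xs) = 0"
    "(\<Sum>xs\<in>L n. W xs * (Y xs)\<^sup>2) = real n * (p * (1 - p))"
proof -
  have L0: "L 0 = {[]}" by (auto simp: L_def)
  define a where "a = (\<lambda>x. (if x \<in> S then 1 else 0) - p)"
  have Ysuc: "Y (x # xs) = a x + Y xs" for x xs
    by (simp add: Y_def a_def count_sat_filter algebra_simps)
  have Wsuc: "W (x # xs) = w x * W xs" for x xs by (simp add: W_def)
  have ind: "(\<Sum>x\<in>A. w x * (if x \<in> S then 1 else 0)) = p"
  proof -
    have "(\<Sum>x\<in>A. w x * (if x \<in> S then 1 else 0)) = (\<Sum>x\<in>A. if x \<in> S then w x else 0)"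
      by (intro sum.cong) auto
    also have "\<dots> = sum w (A \<inter> S)" using fin by (simp add: sum.inter_restrict)
    finally show ?thesis using S by (simp add: p_def Int_absorb1)
  qed
  have a1: "(\<Sum>x\<in>A. w x * a x) = 0"
    using ind w1 by (simp add: a_def right_diff_distrib sum_subtractf flip: sum_distrib_right)
  have a2: "(\<Sum>x\<in>A. w x * (a x)\<^sup>2) = p * (1 - p)"
  proof -
    \<comment> \<open>An indicator equals its own square, so the squared centred indicator is the
      affine combination of indicator and constant written on the right.\<close>
    have "(\<Sum>x\<in>A. w x * (a x)\<^sup>2) =
        (\<Sum>x\<in>A. (1 - 2 * p) * (w x * (if x \<in> S then 1 else 0)) + p\<^sup>2 * w x)"
      by (intro sum.cong refl) (auto simp: a_def power2_eq_square algebra_simps)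
    also have "\<dots> = (1 - 2 * p) * p + p\<^sup>2"
      by (simp add: sum.distrib ind w1 flip: sum_distrib_left)
    finally show ?thesis by (simp add: power2_eq_square algebra_simps)
  qed
  have "sum W (L n) = 1 \<and> (\<Sum>xs\<in>L n. W xs * Y xs) = 0 \<and>
    (\<Sum>xs\<in>L n. W xs * (Y xs)\<^sup>2) = real n * (p * (1 - p))"
  proof (induction n)
    case 0
    show ?case by (simp add: L0) (simp add: W_def Y_def count_sat_filter)
  next
    case (Suc n)
    have step: "(\<Sum>xs\<in>L (Suc n). f xs) = (\<Sum>x\<in>A. \<Sum>xs\<in>L n. f (x # xs))"
      for f :: "'a list \<Rightarrow> real" unfolding L_def by (rule sum_lists_Suc[OF fin])
    have "sum W (L (Suc n)) = sum w A * sum W (L n)"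
      by (simp add: step Wsuc sum_product)
    moreover have "(\<Sum>xs\<in>L (Suc n). W xs * Y xs) =
        (\<Sum>x\<in>A. w x * a x) * sum W (L n) + sum w A * (\<Sum>xs\<in>L n. W xs * Y xs)"
      by (simp only: step Wsuc Ysuc sum_product flip: sum.distrib)
        (simp add: algebra_simps)
    moreover have "(\<Sum>xs\<in>L (Suc n). W xs * (Y xs)\<^sup>2) =
        (\<Sum>x\<in>A. w x * (a x)\<^sup>2) * sum W (L n)
        + 2 * ((\<Sum>x\<in>A. w x * a x) * (\<Sum>xs\<in>L n. W xs * Y xs))
        + sum w A * (\<Sum>xs\<in>L n. W xs * (Y xs)\<^sup>2)"
      by (simp only: step Wsuc Ysuc sum_product sum_distrib_left[of 2] flip: sum.distrib)
        (simp add: algebra_simps power2_eq_square)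
    ultimately show ?case using Suc w1 a1 a2 by (simp add: algebra_simps)
  qed
  then show "sum W (L n) = 1" "(\<Sum>xs\<in>L n. W xs * Y xs) = 0"
    "(\<Sum>xs\<in>L n. W xs * (Y xs)\<^sup>2) = real n * (p * (1 - p))" by auto
qed

text \<open>Quantifying over all subsets at once lets one hypothesis control every event about a
  single ranking; since \<open>A\<close> is finite in the application, this costs only a constant
  factor in the probability bound.\<close>

definition typical :: "('a \<Rightarrow> real) \<Rightarrow> 'a set \<Rightarrow> real \<Rightarrow> 'a list \<Rightarrow> bool" where
  "typical w A \<epsilon> xs \<longleftrightarrow> (\<forall>S\<subseteq>A.
    \<bar>real (count_sat (\<lambda>x. x \<in> S) xs) - real (length xs) * sum w S\<bar> \<le> \<epsilon> * real (length xs))"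

text \<open>Chebyshev's inequality, with the variance \<open>n * (p * (1 - p))\<close> bounded
  crudely by \<open>n\<close>.\<close>

lemma prob_deviation_le:
  fixes w :: "'a \<Rightarrow> real"
  assumes fin: "finite A" and w0: "\<And>x. x \<in> A \<Longrightarrow> 0 \<le> w x" and w1: "sum w A = 1"
    and S: "S \<subseteq> A" and \<epsilon>: "\<epsilon> > 0" and n: "n > 0"
  shows "(\<Sum>xs | (set xs \<subseteq> A \<and> length xs = n) \<and>
      \<not> \<bar>real (count_sat (\<lambda>x. x \<in> S) xs) - real n * sum w S\<bar> \<le> \<epsilon> * real n.
      prod_list (map w xs)) \<le> 1 / (\<epsilon>\<^sup>2 * real n)"
proof -
  define p where "p = sum w S"
  let ?L = "{xs. set xs \<subseteq> A \<and> length xs = n}"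
  define Y where "Y = (\<lambda>xs. real (count_sat (\<lambda>x. x \<in> S) xs) - real n * p)"
  define W where "W = (\<lambda>xs. prod_list (map w xs))"
  have W0: "0 \<le> W xs" if "xs \<in> ?L" for xs
    unfolding W_def using that w0 by (intro prod_list_nonneg) auto
  have finL: "finite ?L" using fin by (rule finite_lists_length_eq)
  let ?B = "{xs. (set xs \<subseteq> A \<and> length xs = n) \<and> \<not> \<bar>Y xs\<bar> \<le> \<epsilon> * real n}"
  have p: "0 \<le> p" "p \<le> 1"
    using w0 S sum_mono2[OF fin S, of w] w1 by (auto simp: p_def intro!: sum_nonneg)
  have pp: "p * (1 - p) \<le> 1" using p by (intro mult_le_one) auto
  have en: "0 < \<epsilon> * real n" using \<epsilon> n by simp
  have "(\<epsilon> * real n)\<^sup>2 * sum W ?B = (\<Sum>xs\<in>?B. W xs * (\<epsilon> * real n)\<^sup>2)"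
    by (subst mult.commute) (rule sum_distrib_right)
  also have "\<dots> \<le> (\<Sum>xs\<in>?B. W xs * (Y xs)\<^sup>2)"
  proof (intro sum_mono mult_left_mono)
    fix xs assume xs: "xs \<in> ?B"
    then have "\<epsilon> * real n \<le> \<bar>Y xs\<bar>" by auto
    then show "(\<epsilon> * real n)\<^sup>2 \<le> (Y xs)\<^sup>2" using en by (metis abs_le_square_iff abs_of_pos)
    show "0 \<le> W xs" using xs W0 by auto
  qed
  also have "\<dots> \<le> (\<Sum>xs\<in>?L. W xs * (Y xs)\<^sup>2)"
    using finL W0 by (intro sum_mono2) auto
  also have "\<dots> = real n * (p * (1 - p))"
    using moments_of_count(3)[OF fin w1 S, of n] by (simp add: W_def Y_def p_def)
  also have "\<dots> \<le> real n * 1" using pp by (intro mult_left_mono) auto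
  finally have "(\<epsilon> * real n)\<^sup>2 * sum W ?B \<le> real n" by simp
  then have "sum W ?B \<le> real n / (\<epsilon> * real n)\<^sup>2"
    by (subst pos_le_divide_eq[OF zero_less_power[OF en]]) (simp only: mult.commute)
  also have "\<dots> = 1 / (\<epsilon>\<^sup>2 * real n)" using n \<epsilon> by (simp add: field_simps power2_eq_square)
  finally show ?thesis by (simp add: W_def Y_def p_def)
qed

text \<open>This separates probability from social choice: what remains is a deterministic claim
  about long typical lists. A list violating \<open>E\<close> is atypical for some \<open>S\<close>,
  and the union bound over the \<open>card (Pow A)\<close> subsets leaves a failure mass of order
  1/n. The bound \<open>N\<close> allows \<open>E\<close> to fail on short lists.\<close>

lemma prob_tendsto_1_if_typical:
  fixes w :: "'a \<Rightarrow> real"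
  assumes fin: "finite A" and w0: "\<And>x. x \<in> A \<Longrightarrow> 0 \<le> w x" and w1: "sum w A = 1"
    and \<epsilon>: "\<epsilon> > 0"
    and E: "\<And>xs. set xs \<subseteq> A \<Longrightarrow> N < length xs \<Longrightarrow> typical w A \<epsilon> xs \<Longrightarrow> E xs"
  shows "(\<lambda>n. \<Sum>xs | set xs \<subseteq> A \<and> length xs = n. if E xs then prod_list (map w xs) else 0)
    \<longlonglongrightarrow> 1"
proof -
  define W where "W = (\<lambda>xs. prod_list (map w xs))"
  let ?L = "\<lambda>n. {xs. set xs \<subseteq> A \<and> length xs = n}"
  let ?B = "\<lambda>n S. {xs. (set xs \<subseteq> A \<and> length xs = n) \<and>
      \<not> \<bar>real (count_sat (\<lambda>x. x \<in> S) xs) - real n * sum w S\<bar> \<le> \<epsilon> * real n}"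
  let ?\<rho> = "\<lambda>n. \<Sum>xs\<in>?L n. if E xs then W xs else 0"
  have finL: "finite (?L n)" for n using fin by (rule finite_lists_length_eq)
  have W0: "0 \<le> W xs" if "xs \<in> ?L n" for xs n
    unfolding W_def using that w0 by (intro prod_list_nonneg) auto
  have tot: "sum W (?L n) = 1" for n
    using moments_of_count(1)[OF fin w1, of "{}" n] by (simp add: W_def)
  have ub: "?\<rho> n \<le> 1" for n
    unfolding tot[of n, symmetric] using W0 by (intro sum_mono) auto
  have lb: "1 - real (card (Pow A)) / \<epsilon>\<^sup>2 / real n \<le> ?\<rho> n" if n: "n > N" for n
  proof -
    have n0: "n > 0" using n by simp
    have "sum W (?L n) - ?\<rho> n = (\<Sum>xs\<in>?L n. if \<not> E xs then W xs else 0)"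
      by (subst sum_subtractf[symmetric], rule sum.cong) auto
    also have "\<dots> = sum W {xs \<in> ?L n. \<not> E xs}"
      using finL by (subst sum.inter_filter) auto
    also have "\<dots> \<le> sum W (\<Union>S\<in>Pow A. ?B n S)"
    proof (rule sum_mono2)
      show "finite (\<Union>S\<in>Pow A. ?B n S)" using fin by (auto intro: finite_subset[OF _ finL[of n]])
      show "{xs \<in> ?L n. \<not> E xs} \<subseteq> (\<Union>S\<in>Pow A. ?B n S)"
      proof
        fix xs assume xs: "xs \<in> {xs \<in> ?L n. \<not> E xs}"
        then have "\<not> typical w A \<epsilon> xs" using E n by auto
        then show "xs \<in> (\<Union>S\<in>Pow A. ?B n S)" using xs unfolding typical_def by blast
      qed
      show "0 \<le> W b" if "b \<in> (\<Union>S\<in>Pow A. ?B n S) - {xs \<in> ?L n. \<not> E xs}" for b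
        using that W0 by blast
    qed
    \<comment> \<open>Union bound: the union is the projection of a disjoint sum, and projecting can
      only merge nonnegative terms.\<close>
    also have "(\<Union>S\<in>Pow A. ?B n S) = snd ` Sigma (Pow A) (?B n)"
      by (rule snd_image_Sigma[symmetric])
    also have "sum W \<dots> \<le> sum (W \<circ> snd) (Sigma (Pow A) (?B n))"
    proof (rule sum_image_le)
      show "finite (Sigma (Pow A) (?B n))"
        using fin by (intro finite_SigmaI) (auto intro: finite_subset[OF _ finL[of n]])
      show "0 \<le> W (snd i)" if "i \<in> Sigma (Pow A) (?B n)" for i
        using that by (intro W0[of _ n]) auto
    qed
    also have "\<dots> = (\<Sum>S\<in>Pow A. sum W (?B n S))"
      using fin by (subst sum.Sigma) (auto intro: finite_subset[OF _ finL[of n]] simp: case_prod_beta)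
    also have "\<dots> \<le> (\<Sum>S\<in>Pow A. 1 / (\<epsilon>\<^sup>2 * real n))"
      unfolding W_def using prob_deviation_le[OF fin w0 w1 _ \<epsilon> n0] by (intro sum_mono) auto
    also have "\<dots> = real (card (Pow A)) / \<epsilon>\<^sup>2 / real n" by simp
    finally show ?thesis unfolding tot by simp
  qed
  have "(\<lambda>n. 1 - real (card (Pow A)) / \<epsilon>\<^sup>2 / real n) \<longlonglongrightarrow> 1 - 0"
    by (intro tendsto_intros lim_const_over_n)
  then have "?\<rho> \<longlonglongrightarrow> 1"
    using lb ub by (intro tendsto_sandwich[of _ ?\<rho> sequentially "\<lambda>_. 1"])
      (auto intro: eventually_mono[OF eventually_gt_at_top[of N]])
  then show ?thesis unfolding W_def .
qed

section \<open>Counting rankings\<close>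

lemma rankingsD:
  assumes "r \<in> rankings m"
  shows "distinct r" "set r = {1..m}"
  using assms by (auto simp: rankings_def)

lemma rankings_eq_permutations: "rankings m = permutations_of_set {1..m}"
  by (auto simp: rankings_def permutations_of_set_def)

lemma finite_rankings [simp]: "finite (rankings m)"
  by (simp add: rankings_eq_permutations)

lemma card_rankings: "card (rankings m) = fact m"
  by (simp add: rankings_eq_permutations)

lemma prefers_asym: "distinct r \<Longrightarrow> prefers r a b \<Longrightarrow> \<not> prefers r b a"
  unfolding prefers_def by (metis nth_eq_iff_index_eq order.strict_trans less_asym)

lemma prefers_trans: "distinct r \<Longrightarrow> prefers r a b \<Longrightarrow> prefers r b c \<Longrightarrow> prefers r a c"
  unfolding prefers_def by (metis nth_eq_iff_index_eq order.strict_trans)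

lemma prefers_total:
  assumes "a \<in> set r" "b \<in> set r" "a \<noteq> b"
  shows "prefers r a b \<or> prefers r b a"
  using assms unfolding prefers_def in_set_conv_nth by (metis nat_neq_iff)

lemma not_prefers_iff:
  assumes "r \<in> rankings m" "a \<in> {1..m}" "b \<in> {1..m}" "a \<noteq> b"
  shows "\<not> prefers r a b \<longleftrightarrow> prefers r b a"
  using prefers_asym prefers_total[of a r b] assms rankingsD[OF assms(1)] by metis

lemma prefers_hd:
  assumes "b \<in> set r" "b \<noteq> hd r"
  shows "prefers r (hd r) b"
proof -
  obtain j where "j < length r" "r ! j = b" using assms by (auto simp: in_set_conv_nth)
  moreover have "r \<noteq> []" using assms by auto
  moreover have "0 < j" using calculation assms by (cases j) (auto simp: hd_conv_nth)
  ultimately show ?thesis unfolding prefers_def by (metis hd_conv_nth)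
qed

section \<open>Exact counts of rankings by swapping two candidates\<close>

lemma prefers_map_inj:
  assumes "inj f"
  shows "prefers (map f r) (f a) (f b) \<longleftrightarrow> prefers r a b"
  using injD[OF assms] unfolding prefers_def by (auto; metis nth_map order.strict_trans)

lemma map_transpose_rankings:
  assumes "a \<in> {1..m}" "b \<in> {1..m}" "r \<in> rankings m"
  shows "map (transpose a b) r \<in> rankings m"
proof -
  have "transpose a b ` {1..m} = {1..m}"
    using assms(1,2) by (simp add: transpose_image_eq)
  then show ?thesis using assms(3)
    by (auto simp: rankings_def distinct_map intro: inj_on_subset[OF inj_transpose])
qed

text \<open>Renaming two candidates is an involution on the rankings. All the counts below are
  obtained from this symmetry instead of enumerating positions.\<close>

lemma card_rankings_transpose:
  assumes a: "a \<in> {1..m}" and b: "b \<in> {1..m}"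
    and \<phi>: "\<And>r. r \<in> rankings m \<Longrightarrow> \<phi> r \<longleftrightarrow> \<psi> (map (transpose a b) r)"
  shows "card {r \<in> rankings m. \<phi> r} = card {r \<in> rankings m. \<psi> r}"
proof -
  let ?f = "map (transpose a b)"
  have inv: "?f (?f r) = r" for r by (simp add: comp_def)
  have "bij_betw ?f {r \<in> rankings m. \<phi> r} {r \<in> rankings m. \<psi> r}"
  proof (rule bij_betw_byWitness[where f' = ?f])
    show "\<forall>r\<in>{r \<in> rankings m. \<phi> r}. ?f (?f r) = r" "\<forall>r\<in>{r \<in> rankings m. \<psi> r}. ?f (?f r) = r"
      using inv by auto
    show "?f ` {r \<in> rankings m. \<phi> r} \<subseteq> {r \<in> rankings m. \<psi> r}"
      using map_transpose_rankings[OF a b] \<phi> by auto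
    show "?f ` {r \<in> rankings m. \<psi> r} \<subseteq> {r \<in> rankings m. \<phi> r}"
      using map_transpose_rankings[OF a b] \<phi> inv by (auto simp: comp_def)
  qed
  then show ?thesis by (rule bij_betw_same_card)
qed

lemma prefers_transpose:
  "prefers (map (transpose a b) r) c d \<longleftrightarrow> prefers r (transpose a b c) (transpose a b d)"
  using prefers_map_inj[OF inj_transpose, of a b r "transpose a b c" "transpose a b d"] by simp

lemma hd_transpose:
  assumes "r \<noteq> []"
  shows "hd (map (transpose a b) r) = c \<longleftrightarrow> hd r = transpose a b c"
  using assms by (auto simp: hd_map)

lemma ranking_nonempty: "r \<in> rankings m \<Longrightarrow> m \<ge> 1 \<Longrightarrow> r \<noteq> []"
  by (auto simp: rankings_def)

text \<open>By symmetry the m classes of rankings with a given top candidate have equal size, and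
  they partition all rankings.\<close>

lemma card_hd:
  assumes c: "c \<in> {1..m}"
  shows "real (card {r \<in> rankings m. hd r = c}) = fact m / real m"
proof -
  have m: "m \<ge> 1" using c by auto
  have same: "card {r \<in> rankings m. hd r = d} = card {r \<in> rankings m. hd r = c}"
    if "d \<in> {1..m}" for d
    using that c m by (intro card_rankings_transpose[of c _ d])
      (auto simp: hd_transpose ranking_nonempty)
  have "rankings m = (\<Union>d\<in>{1..m}. {r \<in> rankings m. hd r = d})"
    using m by (auto simp: rankings_def) (metis atLeastAtMost_iff hd_in_set list.set(1) atLeastatMost_empty_iff2)+
  then have "card (rankings m) = (\<Sum>d\<in>{1..m}. card {r \<in> rankings m. hd r = d})"
    by (subst card_UN_disjoint[symmetric]) auto
  also have "\<dots> = m * card {r \<in> rankings m. hd r = c}"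
    using same by simp
  finally have "fact m = real m * real (card {r \<in> rankings m. hd r = c})"
    by (metis card_rankings of_nat_fact of_nat_mult)
  then show ?thesis using m by (simp add: field_simps)
qed

text \<open>Within a class that the swap of \<open>a\<close> and \<open>b\<close> preserves, the
  swap matches the rankings with \<open>a\<close> above \<open>b\<close> with those having
  \<open>b\<close> above \<open>a\<close>. The class is later either everything or the rankings
  topped by a third candidate.\<close>

lemma card_prefers_invariant:
  assumes a: "a \<in> {1..m}" and b: "b \<in> {1..m}" and ab: "a \<noteq> b"
    and \<phi>: "\<And>r. r \<in> rankings m \<Longrightarrow> \<phi> r \<longleftrightarrow> \<phi> (map (transpose a b) r)"
  shows "real (card {r \<in> rankings m. \<phi> r \<and> prefers r a b}) = real (card {r \<in> rankings m. \<phi> r}) / 2"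
proof -
  let ?S = "\<lambda>a b. {r \<in> rankings m. \<phi> r \<and> prefers r a b}"
  have eq: "card (?S a b) = card (?S b a)"
    using \<phi> by (intro card_rankings_transpose[OF a b]) (auto simp: prefers_transpose)
  have "{r \<in> rankings m. \<phi> r} = ?S a b \<union> ?S b a"
    using not_prefers_iff[OF _ a b ab] by blast
  moreover have "?S a b \<inter> ?S b a = {}"
    using not_prefers_iff[OF _ a b ab] by blast
  ultimately have "card {r \<in> rankings m. \<phi> r} = card (?S a b) + card (?S b a)"
    by (simp add: card_Un_disjoint)
  then show ?thesis using eq by simp
qed

lemma card_prefers:
  assumes "a \<in> {1..m}" "b \<in> {1..m}" "a \<noteq> b"
  shows "real (card {r \<in> rankings m. prefers r a b}) = fact m / 2"
  using card_prefers_invariant[OF assms, of "\<lambda>_. True"] by (simp add: card_rankings)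

lemma card_hd_prefers:
  assumes "a \<in> {1..m}" "b \<in> {1..m}" "a \<noteq> b" "d \<in> {1..m}" "d \<noteq> a" "d \<noteq> b"
  shows "real (card {r \<in> rankings m. hd r = d \<and> prefers r a b}) = fact m / (2 * real m)"
proof -
  have "hd r = d \<longleftrightarrow> hd (map (transpose a b) r) = d" if "r \<in> rankings m" for r
    using assms that ranking_nonempty[OF that] by (subst hd_transpose) auto
  then show ?thesis
    using card_prefers_invariant[OF assms(1-3), of "\<lambda>r. hd r = d"] card_hd[OF assms(4)] by simp
qed

text \<open>Among the rankings with \<open>a\<close> above \<open>b\<close>, the candidate
  \<open>c\<close> is below, between or above them. Single swaps show that these three classes have
  equal size, so each is a third of one half.\<close>

lemma card_prefers_chain:
  assumes a: "a \<in> {1..m}" and b: "b \<in> {1..m}" and c: "c \<in> {1..m}"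
    and ne: "a \<noteq> b" "a \<noteq> c" "b \<noteq> c"
  shows "real (card {r \<in> rankings m. prefers r a b \<and> prefers r b c}) = fact m / 6"
proof -
  let ?T = "\<lambda>a b c. {r \<in> rankings m. prefers r a b \<and> prefers r b c}"
  have e1: "card (?T a c b) = card (?T a b c)"
    using ne by (intro card_rankings_transpose[OF b c]) (auto simp: prefers_transpose)
  have e2: "card (?T c a b) = card (?T a c b)"
    using ne by (intro card_rankings_transpose[OF a c]) (auto simp: prefers_transpose)
  have "{r \<in> rankings m. prefers r a b} = ?T a b c \<union> ?T a c b \<union> ?T c a b"
    using not_prefers_iff[OF _ a c] not_prefers_iff[OF _ b c] ne prefers_trans rankingsD(1) by blast
  moreover have "?T a b c \<inter> ?T a c b = {}"
    using prefers_asym rankingsD(1) by blast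
  moreover have "(?T a b c \<union> ?T a c b) \<inter> ?T c a b = {}"
    using prefers_asym prefers_trans rankingsD(1) by blast
  ultimately have "card {r \<in> rankings m. prefers r a b} = card (?T a b c) + card (?T a c b) + card (?T c a b)"
    by (simp add: card_Un_disjoint)
  then show ?thesis using e1 e2 card_prefers[OF a b ne(1)] by simp
qed

section \<open>Ballot frequencies in the perturbed culture\<close>

lemma prefers_upt:
  assumes "a \<in> {1..m}" "b \<in> {1..m}"
  shows "prefers [1..<m+1] a b \<longleftrightarrow> a < b"
proof
  assume "a < b"
  then show "prefers [1..<m+1] a b" unfolding prefers_def
    using assms by (intro exI[of _ "a - 1"] exI[of _ "b - 1"]) (auto simp del: upt_Suc)
qed (auto simp: prefers_def simp del: upt_Suc)

lemma hd_upt_1: "m \<ge> 1 \<Longrightarrow> hd [1..<m+1] = 1"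
  by (simp add: upt_rec)

lemma identity_in_rankings: "[1..<m+1] \<in> rankings m"
  by (auto simp: rankings_def)

text \<open>The culture is a mixture of a point mass at \<open>[1..<m+1]\<close> and the uniform
  distribution, so each probability reduces to one membership test and one count.\<close>

lemma sum_pc_prob:
  "sum (pc_prob m \<theta>) {r \<in> rankings m. \<phi> r} =
    (if \<phi> [1..<m+1] then \<theta> else 0) + (1 - \<theta>) * (real (card {r \<in> rankings m. \<phi> r}) / fact m)"
proof -
  have "(\<Sum>r\<in>{r \<in> rankings m. \<phi> r}. if r = [1..<m+1] then \<theta> else 0) =
    (if \<phi> [1..<m+1] then \<theta> else 0)"
    using identity_in_rankings[of m] by (subst sum.delta) auto
  then show ?thesis by (simp add: pc_prob_def sum.distrib)
qed

lemma sum_pc_prob_rankings: "sum (pc_prob m \<theta>) (rankings m) = 1"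
  using sum_pc_prob[of m \<theta> "\<lambda>_. True"] by (simp add: card_rankings)

lemma sum_pc_prob_hd:
  assumes "c \<in> {1..m}"
  shows "sum (pc_prob m \<theta>) {r \<in> rankings m. hd r = c} =
    (if c = 1 then \<theta> else 0) + (1 - \<theta>) / real m"
  using assms hd_upt_1[of m] by (simp add: sum_pc_prob card_hd)

lemma sum_pc_prob_prefers:
  assumes "a \<in> {1..m}" "b \<in> {1..m}" "a \<noteq> b"
  shows "sum (pc_prob m \<theta>) {r \<in> rankings m. prefers r a b} =
    (if a < b then \<theta> else 0) + (1 - \<theta>) / 2"
  using assms prefers_upt[OF assms(1,2)] by (simp add: sum_pc_prob card_prefers)

text \<open>Since \<open>d\<close> is not 1, the point mass lies outside the event and only the
  uniform part contributes.\<close>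

lemma sum_pc_prob_hd_prefers:
  assumes "a \<in> {1..m}" "b \<in> {1..m}" "a \<noteq> b" "d \<in> {1..m}" "d \<noteq> a" "d \<noteq> b" "d \<noteq> 1"
  shows "sum (pc_prob m \<theta>) {r \<in> rankings m. hd r = d \<and> prefers r a b} =
    (1 - \<theta>) / (2 * real m)"
  using assms hd_upt_1[of m] by (simp add: sum_pc_prob card_hd_prefers)

lemma sum_pc_prob_chain:
  assumes "a \<in> {1..m}" "b \<in> {1..m}" "c \<in> {1..m}" "a < b" "b < c"
  shows "sum (pc_prob m \<theta>) {r \<in> rankings m. prefers r a b \<and> prefers r b c} =
    \<theta> + (1 - \<theta>) / 6"
  using assms prefers_upt[OF assms(1,2)] prefers_upt[OF assms(2,3)]
  by (simp add: sum_pc_prob card_prefers_chain)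

text \<open>Bridge from sets of rankings to predicates, with the probability as a separate value
  \<open>q\<close> so that the closed forms above can be plugged in.\<close>

lemma typical_count:
  assumes "typical (pc_prob m \<theta>) (rankings m) \<epsilon> P" and P: "set P \<subseteq> rankings m"
    and q: "sum (pc_prob m \<theta>) {r \<in> rankings m. \<phi> r} = q"
  shows "\<bar>real (count_sat \<phi> P) - real (length P) * q\<bar> \<le> \<epsilon> * real (length P)"
proof -
  define S where "S = {r \<in> rankings m. \<phi> r}"
  have "S \<subseteq> rankings m" by (auto simp: S_def)
  then have "\<bar>real (count_sat (\<lambda>r. r \<in> S) P) - real (length P) * sum (pc_prob m \<theta>) S\<bar>
      \<le> \<epsilon> * real (length P)"
    using assms(1) by (simp add: typical_def)
  moreover have "count_sat (\<lambda>r. r \<in> S) P = count_sat \<phi> P"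
    unfolding count_sat_def S_def using P by (auto intro!: arg_cong[where f = card])
  ultimately show ?thesis using q by (simp add: S_def)
qed

section \<open>The outcome of the two-round system\<close>

text \<open>Ensures that each set handed to \<open>tb\<close> is nonempty, so that the assumption on
  \<open>tb\<close> applies.\<close>

lemma argmax_nonempty:
  fixes f :: "'a \<Rightarrow> nat"
  assumes "finite A" "A \<noteq> {}"
  shows "{c \<in> A. \<forall>d\<in>A. f d \<le> f c} \<noteq> {}"
proof -
  have "Max (f ` A) \<in> f ` A" using assms by simp
  then obtain c where "c \<in> A" "f c = Max (f ` A)" by auto
  then show ?thesis using assms(1) by auto
qed

lemma plu_score_count: "plu_score P c = count_sat (\<lambda>r. hd r = c) P"
  by (simp add: plu_score_def count_sat_def)

lemma plu_score_restr_pair: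
  assumes "a \<noteq> b"
  shows "plu_score_restr P {a, b} a = count_sat (\<lambda>r. prefers r a b) P"
proof -
  have "{a, b} - {a} = {b}" using assms by auto
  then show ?thesis by (simp add: plu_score_restr_def count_sat_def)
qed

text \<open>All later arguments about outcomes go through these properties of the winner and the
  losing finalist \<open>l\<close>. The inequalities are weak, so they hold however ties are broken,
  and they do not record which finalist led the first round.\<close>

lemma TR_runner_up:
  fixes P :: "nat list list" and tb :: "nat set \<Rightarrow> nat"
  assumes m: "m \<ge> 2" and tb: "\<And>S. S \<subseteq> {1..m} \<Longrightarrow> S \<noteq> {} \<Longrightarrow> tb S \<in> S"
  defines "w \<equiv> TR tb m P"
  obtains l where "w \<in> {1..m}" "l \<in> {1..m}" "w \<noteq> l"
    "\<And>e. e \<in> {1..m} - {w, l} \<Longrightarrow> plu_score P e \<le> plu_score P w \<and> plu_score P e \<le> plu_score P l"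
    "count_sat (\<lambda>r. prefers r l w) P \<le> count_sat (\<lambda>r. prefers r w l) P"
proof -
  define A where "A = {1..m}"
  define S1 where "S1 = {c \<in> A. \<forall>d\<in>A. plu_score P d \<le> plu_score P c}"
  define B where "B = A - {tb S1}"
  define S2 where "S2 = {c \<in> B. \<forall>d\<in>B. plu_score P d \<le> plu_score P c}"
  define K where "K = {tb S1, tb S2}"
  define S3 where "S3 = {c \<in> K. \<forall>d\<in>K. plu_score_restr P K d \<le> plu_score_restr P K c}"
  have w: "w = tb S3"
    unfolding w_def TR_def Let_def S3_def K_def S2_def B_def S1_def A_def by simp
  have "S1 \<noteq> {}" unfolding S1_def using m by (intro argmax_nonempty) (auto simp: A_def)
  then have f1: "tb S1 \<in> S1" by (intro tb) (auto simp: S1_def A_def)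
  have "card B = m - 1" using f1 by (simp add: B_def A_def S1_def)
  then have "B \<noteq> {}" using m by auto
  then have "S2 \<noteq> {}" unfolding S2_def by (intro argmax_nonempty) (auto simp: A_def B_def)
  then have f2: "tb S2 \<in> S2" by (intro tb) (auto simp: S2_def A_def B_def)
  have "S3 \<noteq> {}" unfolding S3_def by (intro argmax_nonempty) (auto simp: K_def)
  moreover have KA: "K \<subseteq> A" using f1 f2 by (auto simp: K_def S1_def S2_def B_def)
  ultimately have f3: "w \<in> S3" unfolding w by (intro tb) (auto simp: S3_def A_def)
  have ne: "tb S1 \<noteq> tb S2" using f2 by (auto simp: S2_def B_def)
  define l where "l = (if w = tb S1 then tb S2 else tb S1)"
  have "w \<in> K" using f3 by (simp add: S3_def)
  then have l: "K = {w, l}" "w \<noteq> l" using ne by (auto simp: K_def l_def)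
  show ?thesis
  proof (rule that[of l])
    show "w \<in> {1..m}" "l \<in> {1..m}" "w \<noteq> l" using l KA by (auto simp: A_def)
    show "plu_score P e \<le> plu_score P w \<and> plu_score P e \<le> plu_score P l"
      if e: "e \<in> {1..m} - {w, l}" for e
    proof -
      have "\<forall>k\<in>K. plu_score P e \<le> plu_score P k"
        using f1 f2 e l(1)[symmetric] by (auto simp: K_def S1_def S2_def A_def B_def)
      then show ?thesis using l by auto
    qed
    have "plu_score_restr P K l \<le> plu_score_restr P K w" using f3 l by (auto simp: S3_def)
    then show "count_sat (\<lambda>r. prefers r l w) P \<le> count_sat (\<lambda>r. prefers r w l) P"
      using plu_score_restr_pair[OF l(2), of P] plu_score_restr_pair[OF l(2)[symmetric], of P] l(1)
      by (simp add: insert_commute)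
  qed
qed

section \<open>Deterministic conditions for the outcome, for immunity and for manipulability\<close>

lemma count_prefers_compl:
  assumes P: "set P \<subseteq> rankings m" and ab: "a \<in> {1..m}" "b \<in> {1..m}" "a \<noteq> b"
  shows "count_sat (\<lambda>r. prefers r a b) P + count_sat (\<lambda>r. prefers r b a) P = length P"
proof -
  have "filter (\<lambda>r. prefers r b a) P = filter (\<lambda>r. \<not> prefers r a b) P"
    using P ab not_prefers_iff[of _ m a b] by (intro filter_cong) auto
  then show ?thesis by (simp add: count_sat_filter sum_length_filter_compl)
qed

text \<open>If another candidate won, then \<open>c\<close>, which outscores it, would be the other
  finalist. It would then have lost a duel in which it has a strict majority.\<close>

lemma TR_eq_front_runner:
  assumes m: "m \<ge> 2" and tb: "\<And>S. S \<subseteq> {1..m} \<Longrightarrow> S \<noteq> {} \<Longrightarrow> tb S \<in> S"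
    and P: "set P \<subseteq> rankings m" and c: "c \<in> {1..m}"
    and plu: "\<And>d. d \<in> {1..m} - {c} \<Longrightarrow> plu_score P d < plu_score P c"
    and maj: "\<And>d. d \<in> {1..m} - {c} \<Longrightarrow> 2 * count_sat (\<lambda>r. prefers r d c) P < length P"
  shows "TR tb m P = c"
proof (rule ccontr)
  obtain l where l: "TR tb m P \<in> {1..m}" "l \<in> {1..m}"
      "\<And>e. e \<in> {1..m} - {TR tb m P, l} \<Longrightarrow> plu_score P e \<le> plu_score P (TR tb m P)"
      "count_sat (\<lambda>r. prefers r l (TR tb m P)) P \<le> count_sat (\<lambda>r. prefers r (TR tb m P) l) P"
    using TR_runner_up[OF m tb, of P] by metis
  assume ne: "TR tb m P \<noteq> c"
  then have d: "TR tb m P \<in> {1..m} - {c}" using l(1) by auto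
  have "l = c" using l(3)[of c] plu[OF d] c ne by force
  then show False using l(4) maj[OF d] count_prefers_compl[OF P l(1) c ne] by simp
qed

text \<open>Suppose \<open>w\<close> wins after a manipulation. If 1 is the other finalist, it still
  has its majority against \<open>w\<close>. Otherwise both finalists score at least as much as 1,
  which loses no first place; but their joint score is at most the number of supporters of
  \<open>w\<close> against 1 plus the number of sincere first places of \<open>l\<close> among the
  other voters.\<close>

lemma not_TR_CM_if:
  assumes m: "m \<ge> 2" and tb: "\<And>S. S \<subseteq> {1..m} \<Longrightarrow> S \<noteq> {} \<Longrightarrow> tb S \<in> S"
    and P: "set P \<subseteq> rankings m" and TR: "TR tb m P = 1"
    and maj: "\<And>c. c \<in> {2..m} \<Longrightarrow> 2 * count_sat (\<lambda>r. prefers r c 1) P < length P"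
    and plu: "\<And>c d. c \<in> {2..m} \<Longrightarrow> d \<in> {2..m} \<Longrightarrow> c \<noteq> d \<Longrightarrow>
      count_sat (\<lambda>r. prefers r c 1) P + count_sat (\<lambda>r. hd r = d \<and> prefers r 1 c) P
        < 2 * plu_score P 1"
  shows "\<not> TR_CM tb m P"
proof
  let ?n = "length P"
  assume "TR_CM tb m P"
  then obtain Q where Q: "set Q \<subseteq> rankings m" "length Q = ?n" "TR tb m Q \<noteq> 1"
    and dev: "\<And>v. v < ?n \<Longrightarrow> Q ! v \<noteq> P ! v \<Longrightarrow> prefers (P ! v) (TR tb m Q) 1"
    unfolding TR_CM_def profiles_def TR by auto
  define w where "w = TR tb m Q"
  obtain l where l: "w \<in> {1..m}" "l \<in> {1..m}" "w \<noteq> l"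
    "\<And>e. e \<in> {1..m} - {w, l} \<Longrightarrow> plu_score Q e \<le> plu_score Q w \<and> plu_score Q e \<le> plu_score Q l"
    "count_sat (\<lambda>r. prefers r l w) Q \<le> count_sat (\<lambda>r. prefers r w l) Q"
    using TR_runner_up[OF m tb, of Q] unfolding w_def by metis
  have w1: "w \<noteq> 1" using Q w_def by simp
  have w2: "w \<in> {2..m}" using w1 l(1) by auto
  have one: "1 \<in> {1..m}" using m by auto
  have inR: "P ! v \<in> rankings m" "Q ! v \<in> rankings m" if "v < ?n" for v
    using that P Q(1,2) by (auto simp: subset_iff)
  \<comment> \<open>Only voters who gain from the change may deviate, so everyone preferring 1 to
    \<open>w\<close> votes sincerely.\<close>
  have same: "Q ! v = P ! v" if "v < ?n" "prefers (P ! v) 1 w" for v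
    using that dev[of v] inR[of v] not_prefers_iff[OF _ one l(1), of "P ! v"] w1 unfolding w_def by metis
  show False
  proof (cases "l = 1")
    case True
    \<comment> \<open>The sincere ballots placing 1 above \<open>w\<close> survive, and insincere
      ones can only add to them.\<close>
    have "count_sat (\<lambda>r. prefers r 1 w) P \<le> count_sat (\<lambda>r. prefers r 1 w) Q"
      unfolding count_sat_def using Q(2) same by (intro card_mono) auto
    then show False
      using maj[OF w2] l(5) count_prefers_compl[OF P l(1) one w1]
        count_prefers_compl[OF Q(1) l(1) one w1] Q(2) unfolding True by simp
  next
    case False
    then have l2: "l \<in> {2..m}" using l(2) by auto
    have hd1: "prefers (P ! v) 1 w" if "v < ?n" "hd (P ! v) = 1" for v
      using prefers_hd[of w "P ! v"] that inR[of v] l(1) w1 by (auto simp: rankings_def)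
    have "plu_score P 1 \<le> plu_score Q 1"
      unfolding plu_score_def using Q(2) same hd1 by (intro card_mono) auto
    moreover have "plu_score Q 1 \<le> plu_score Q w" "plu_score Q 1 \<le> plu_score Q l"
      using l(4)[of 1] False w1 one by auto
    moreover have "plu_score Q w + plu_score Q l \<le>
      count_sat (\<lambda>r. prefers r w 1) P + count_sat (\<lambda>r. hd r = l \<and> prefers r 1 w) P"
    proof -
      \<comment> \<open>A voter preferring 1 to \<open>w\<close> is sincere, so a ballot topped by
        \<open>w\<close> would contradict that preference.\<close>
      have ww: "prefers (P ! v) w 1" if "v < ?n" "hd (Q ! v) = w" for v
      proof (rule ccontr)
        assume "\<not> prefers (P ! v) w 1"
        then have *: "prefers (P ! v) 1 w" using not_prefers_iff[OF _ l(1) one w1] inR that by auto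
        then have "hd (P ! v) = w" using same that by auto
        then have "prefers (P ! v) w 1"
          using prefers_hd[of 1 "P ! v"] inR(1)[OF that(1)] one w1 by (auto simp: rankings_def)
        then show False using * prefers_asym rankingsD(1) inR(1)[OF that(1)] by blast
      qed
      have ll: "prefers (P ! v) w 1 \<or> hd (P ! v) = l \<and> prefers (P ! v) 1 w"
        if "v < ?n" "hd (Q ! v) = l" for v
        using not_prefers_iff[OF inR(1)[OF that(1)] l(1) one w1] same that by auto
      \<comment> \<open>A ballot has a single top candidate, so the two groups of voters are
        disjoint and each supporter of \<open>w\<close> is counted only once in the bound.\<close>
      have "plu_score Q w + plu_score Q l =
          card ({v. v < ?n \<and> hd (Q ! v) = w} \<union> {v. v < ?n \<and> hd (Q ! v) = l})"
        unfolding plu_score_def Q(2) using l(3) by (subst card_Un_disjoint) auto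
      also have "\<dots> \<le> card ({v. v < ?n \<and> prefers (P ! v) w 1} \<union>
          {v. v < ?n \<and> hd (P ! v) = l \<and> prefers (P ! v) 1 w})"
        using ww ll by (intro card_mono) auto
      also have "\<dots> \<le> count_sat (\<lambda>r. prefers r w 1) P + count_sat (\<lambda>r. hd r = l \<and> prefers r 1 w) P"
        unfolding count_sat_def by (rule card_Un_le)
      finally show ?thesis .
    qed
    ultimately show False using plu[OF w2 l2 l(3)] by simp
  qed
qed

lemma ranking_with_hd:
  assumes "c \<in> {1..m}"
  obtains r where "r \<in> rankings m" "hd r = c"
proof (rule that[of "c # remove1 c [1..<m+1]"])
  show "c # remove1 c [1..<m+1] \<in> rankings m"
    using assms by (auto simp: rankings_def set_remove1_eq simp del: upt_Suc)
qed simp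

text \<open>The supporters of 2 against 1 divide their ballots: just enough of them vote for 3 to push
  3 past 1 in the first round, and all others vote for 2.\<close>
lemma TR_CM_if:
  fixes P :: "nat list list" and tb :: "nat set \<Rightarrow> nat"
  assumes m: "m \<ge> 3" and tb: "\<And>S. S \<subseteq> {1..m} \<Longrightarrow> S \<noteq> {} \<Longrightarrow> tb S \<in> S"
    and P: "set P \<subseteq> rankings m" and TR: "TR tb m P = 1"
  defines "M \<equiv> count_sat (\<lambda>r. prefers r 2 1) P"
    and "B \<equiv> count_sat (\<lambda>r. hd r = 3 \<and> prefers r 1 2) P"
    and "E \<equiv> count_sat (\<lambda>r. prefers r 1 2 \<and> prefers r 2 3) P"
  assumes BA: "B \<le> plu_score P 1"
    and plu: "2 * plu_score P 1 + 1 < M + B"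
    and maj: "length P + 2 * plu_score P 1 + 2 < 2 * (E + M + B)"
    and others: "\<And>e. e \<in> {4..m} \<Longrightarrow> count_sat (\<lambda>r. hd r = e \<and> prefers r 1 2) P \<le> plu_score P 1"
  shows "TR_CM tb m P"
proof -
  let ?n = "length P"
  have in3: "1 \<in> {1..m}" "2 \<in> {1..m}" "3 \<in> {1..m}" using m by auto
  obtain r2 where r2: "r2 \<in> rankings m" "hd r2 = 2" using ranking_with_hd[OF in3(2)] .
  obtain r3 where r3: "r3 \<in> rankings m" "hd r3 = 3" using ranking_with_hd[OF in3(3)] .
  have r2p: "prefers r2 2 3" using prefers_hd[of 3 r2] r2 in3 by (auto simp: rankings_def)
  define V where "V = {v. v < ?n \<and> prefers (P ! v) 2 1}"
  have cV: "card V = M" by (simp add: V_def M_def count_sat_def)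
  \<comment> \<open>Candidate 3 keeps \<open>B\<close> first places from voters outside
    \<open>V\<close>; \<open>x\<close> further ones bring these to exactly one more than the sincere
    score of 1. By \<open>BA\<close> the natural subtraction does not truncate.\<close>
  define x where "x = plu_score P 1 - B + 1"
  have "x \<le> card V" using plu BA unfolding cV x_def by simp
  then obtain D where D: "D \<subseteq> V" "card D = x" using obtain_subset_with_card_n by metis
  define Q where "Q = map (\<lambda>v. if v \<in> D then r3 else if v \<in> V then r2 else P ! v) [0..<?n]"
  have lQ: "length Q = ?n" by (simp add: Q_def)
  have Qv: "Q ! v = (if v \<in> D then r3 else if v \<in> V then r2 else P ! v)" if "v < ?n" for v
    using that by (simp add: Q_def)
  have Q: "set Q \<subseteq> rankings m" using P r2 r3 by (auto simp: Q_def)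
  have finV: "finite V" by (simp add: V_def)
  have finD: "finite D" using D finV finite_subset by blast
  have VD: "card (V - D) = M - x" using D finD cV by (simp add: card_Diff_subset)
  have Vn: "v < ?n" if "v \<in> V" for v using that by (simp add: V_def)
  have notV: "v \<notin> V" if "v < ?n" "prefers (P ! v) 1 2" for v
  proof -
    have "P ! v \<in> rankings m" using that P by auto
    then show ?thesis using that prefers_asym rankingsD(1) unfolding V_def by blast
  qed
  have pref12: "prefers (P ! v) 1 2" if "v < ?n" "v \<notin> V" for v
    using that not_prefers_iff[OF _ in3(2,1), of "P ! v"] subsetD[OF P nth_mem] unfolding V_def by auto
  have s1: "plu_score Q 1 \<le> plu_score P 1"
    unfolding plu_score_def lQ using r2 r3 by (intro card_mono) (auto simp: Qv split: if_splits)
  \<comment> \<open>The coalition tops only 2 or 3, so first places of \<open>e\<close> come from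
    sincere voters outside \<open>V\<close>.\<close>
  have se: "plu_score Q e \<le> plu_score P 1" if e: "e \<in> {4..m}" for e
  proof -
    have "plu_score Q e \<le> count_sat (\<lambda>r. hd r = e \<and> prefers r 1 2) P"
      unfolding plu_score_def count_sat_def lQ using r2 r3 e D pref12
      by (intro card_mono) (auto simp: Qv split: if_splits)
    then show ?thesis using others[OF e] by simp
  qed
  \<comment> \<open>The \<open>M - x\<close> coalition members left for 2 number
    \<open>M + B - plu_score P 1 - 1\<close>, which exceeds the score of 1 by the assumption
    \<open>plu\<close>.\<close>
  have s2: "plu_score P 1 < plu_score Q 2"
  proof -
    have "M - x \<le> plu_score Q 2"
      unfolding plu_score_def lQ VD[symmetric] using r2 Vn by (intro card_mono) (auto simp: Qv)
    then show ?thesis using plu BA unfolding x_def by simp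
  qed
  have s3: "plu_score P 1 < plu_score Q 3"
  proof -
    let ?B = "{v. v < ?n \<and> hd (P ! v) = 3 \<and> prefers (P ! v) 1 2}"
    have "x + B = card (D \<union> ?B)"
      using D notV finD by (subst card_Un_disjoint) (auto simp: B_def count_sat_def)
    also have "\<dots> \<le> plu_score Q 3"
      unfolding plu_score_def lQ using r3 Vn D notV by (intro card_mono) (auto simp: Qv)
    finally show ?thesis using BA unfolding x_def by simp
  qed
  \<comment> \<open>In the duel with 3, candidate 2 has the \<open>M - x\<close> coalition ballots
    topped by 2 and the \<open>E\<close> sincere ballots ranking 1, 2, 3 in this order. With the
    value of \<open>x\<close>, the assumption \<open>maj\<close> says that these form a strict
    majority.\<close>
  have maj23: "?n < 2 * count_sat (\<lambda>r. prefers r 2 3) Q"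
  proof -
    let ?E = "{v. v < ?n \<and> prefers (P ! v) 1 2 \<and> prefers (P ! v) 2 3}"
    have "(M - x) + E = card ((V - D) \<union> ?E)"
      using VD notV finV by (subst card_Un_disjoint) (auto simp: E_def count_sat_def)
    also have "\<dots> \<le> count_sat (\<lambda>r. prefers r 2 3) Q"
      unfolding count_sat_def lQ using r2p Vn D notV by (intro card_mono) (auto simp: Qv subset_iff)
    finally show ?thesis using maj BA plu unfolding x_def by simp
  qed
  have "TR tb m Q = 2"
  proof -
    have m2: "m \<ge> 2" using m by simp
    define w where "w = TR tb m Q"
    obtain l where l: "w \<in> {1..m}" "l \<in> {1..m}" "w \<noteq> l"
      "\<And>e. e \<in> {1..m} - {w, l} \<Longrightarrow> plu_score Q e \<le> plu_score Q w \<and> plu_score Q e \<le> plu_score Q l"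
      "count_sat (\<lambda>r. prefers r l w) Q \<le> count_sat (\<lambda>r. prefers r w l) Q"
      using TR_runner_up[OF m2 tb, of Q] unfolding w_def by metis
    have small: "plu_score Q e \<le> plu_score P 1" if "e \<in> {1..m} - {2, 3}" for e
      using that s1 se[of e] by (cases "e = 1") auto
    \<comment> \<open>If 2 or 3 were eliminated, some finalist would lie outside {2, 3} and score at
      most \<open>plu_score P 1\<close>, less than the eliminated candidate.\<close>
    have "2 \<in> {w, l}" "3 \<in> {w, l}"
      using l(1-4) s2 s3 small in3
      by (metis Diff_iff empty_iff insert_iff leD order_trans le_less_trans)+
    then consider "w = 2" | "w = 3" "l = 2" by auto
    then have "w = 2"
    proof cases
      case 2
      then show ?thesis
        using l(5) maj23 count_prefers_compl[OF Q in3(2,3)] lQ by simp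
    qed
    then show ?thesis by (simp add: w_def)
  qed
  moreover have "Q \<in> profiles m ?n" using Q lQ by (simp add: profiles_def)
  moreover have "prefers (P ! v) 2 1" if "v < ?n" "Q ! v \<noteq> P ! v" for v
    using that D Qv[of v] by (auto simp: V_def split: if_splits)
  ultimately show ?thesis unfolding TR_CM_def TR
    by (intro bexI[of _ Q]) auto
qed

section \<open>The phase transition\<close>

lemma rho_TR_eq:
  "rho_TR tb m n \<theta> = (\<Sum>P | set P \<subseteq> rankings m \<and> length P = n.
    if TR_CM tb m P then prod_list (map (pc_prob m \<theta>) P) else 0)"
  unfolding rho_TR_def profiles_def
  by (intro sum.cong) (auto simp: prod.list_conv_set_nth atLeast0LessThan)

text \<open>The expected lead of 1 is \<theta> n both in first places over \<open>d\<close> and in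
  the duel against \<open>d\<close>. Either comparison loses at most 2 \<epsilon> n to
  deviations.\<close>

lemma TR_eq_1_if_typical:
  assumes m: "m \<ge> 2" and tb: "\<And>S. S \<subseteq> {1..m} \<Longrightarrow> S \<noteq> {} \<Longrightarrow> tb S \<in> S"
    and P: "set P \<subseteq> rankings m" "P \<noteq> []"
    and typical_P: "typical (pc_prob m \<theta>) (rankings m) \<epsilon> P" and \<epsilon>: "2 * \<epsilon> < \<theta>"
  shows "TR tb m P = 1" "\<And>c. c \<in> {2..m} \<Longrightarrow> 2 * count_sat (\<lambda>r. prefers r c 1) P < length P"
proof -
  define x where "x = real (length P)"
  have x: "x > 0" using P by (simp add: x_def)
  have \<epsilon>x: "2 * (\<epsilon> * x) < x * \<theta>" using \<epsilon> x by (simp add: mult.commute)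
  \<comment> \<open>The expected number of first places that each candidate gets from the uniform
    part. Naming it makes the estimates linear in \<open>s\<close>, \<open>x\<close>,
    \<open>x * \<theta>\<close> and \<open>\<epsilon> * x\<close>.\<close>
  define s where "s = x * ((1 - \<theta>) / real m)"
  note cnt = typical_count[OF typical_P P(1), folded x_def]
  have one: "1 \<in> {1..m}" using m by auto
  have maj: "2 * count_sat (\<lambda>r. prefers r d 1) P < length P" if "d \<in> {1..m} - {1}" for d
  proof -
    have "\<bar>real (count_sat (\<lambda>r. prefers r d 1) P) - (x - x * \<theta>) / 2\<bar> \<le> \<epsilon> * x"
      using cnt[OF sum_pc_prob_prefers[of d m 1 \<theta>]] that one by (simp add: right_diff_distrib)
    then have "real (count_sat (\<lambda>r. prefers r d 1) P) \<le> (x - x * \<theta>) / 2 + \<epsilon> * x"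
      by (simp only: abs_le_iff) linarith
    then have "2 * real (count_sat (\<lambda>r. prefers r d 1) P) < x"
      using \<epsilon>x by (simp add: field_simps)
    then show ?thesis unfolding x_def by linarith
  qed
  have "plu_score P d < plu_score P 1" if "d \<in> {1..m} - {1}" for d
  proof -
    have "\<bar>real (plu_score P d) - s\<bar> \<le> \<epsilon> * x"
      using cnt[OF sum_pc_prob_hd[of d m \<theta>]] that by (simp add: plu_score_count s_def)
    moreover have "\<bar>real (plu_score P 1) - (x * \<theta> + s)\<bar> \<le> \<epsilon> * x"
      using cnt[OF sum_pc_prob_hd[OF one, of \<theta>]]
      by (simp add: plu_score_count distrib_left s_def)
    ultimately have "real (plu_score P d) < real (plu_score P 1)" using \<epsilon>x by linarith
    then show ?thesis by simp
  qed
  then show "TR tb m P = 1" using TR_eq_front_runner[OF m tb P(1) one] maj by blast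
  show "2 * count_sat (\<lambda>r. prefers r c 1) P < length P" if "c \<in> {2..m}" for c
    using maj that by auto
qed

text \<open>The right side of \<open>gap\<close> is the expected deficit per voter of the coalition,
  2 (\<theta> + q) - (1 - \<theta>)/2 - q/2 with q = (1 - \<theta>)/m. Its factor 4 counts
  deviations: two for the doubled score of 1 and one for each of the other two counts.\<close>

lemma not_TR_CM_if_typical:
  assumes m: "m \<ge> 2" and tb: "\<And>S. S \<subseteq> {1..m} \<Longrightarrow> S \<noteq> {} \<Longrightarrow> tb S \<in> S"
    and P: "set P \<subseteq> rankings m" "P \<noteq> []"
    and typical_P: "typical (pc_prob m \<theta>) (rankings m) \<epsilon> P" and \<epsilon>: "2 * \<epsilon> < \<theta>"
    and gap: "4 * \<epsilon> < 2 * \<theta> + 3 / 2 * ((1 - \<theta>) / real m) - (1 - \<theta>) / 2"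
  shows "\<not> TR_CM tb m P"
proof (rule not_TR_CM_if[OF m tb P(1)])
  show "TR tb m P = 1" and "\<And>c. c \<in> {2..m} \<Longrightarrow> 2 * count_sat (\<lambda>r. prefers r c 1) P < length P"
    using TR_eq_1_if_typical[OF m tb P typical_P \<epsilon>] by blast+
  fix c d assume cd: "c \<in> {2..m}" "d \<in> {2..m}" "c \<noteq> d"
  define x where "x = real (length P)"
  define s where "s = x * ((1 - \<theta>) / real m)"
  have x: "x > 0" using P by (simp add: x_def)
  note cnt = typical_count[OF typical_P P(1), folded x_def]
  have one: "1 \<in> {1..m}" using m by auto
  have "x * (4 * \<epsilon>) < x * (2 * \<theta> + 3 / 2 * ((1 - \<theta>) / real m) - (1 - \<theta>) / 2)"
    using gap x by (rule mult_strict_left_mono)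
  then have g: "4 * (\<epsilon> * x) < 2 * (x * \<theta>) + 3 / 2 * s - x * ((1 - \<theta>) / 2)"
    unfolding s_def by (simp add: algebra_simps)
  have "\<bar>real (plu_score P 1) - (x * \<theta> + s)\<bar> \<le> \<epsilon> * x"
    using cnt[OF sum_pc_prob_hd[OF one, of \<theta>]]
    by (simp add: plu_score_count distrib_left s_def)
  moreover have "\<bar>real (count_sat (\<lambda>r. prefers r c 1) P) - x * ((1 - \<theta>) / 2)\<bar> \<le> \<epsilon> * x"
    using cnt[OF sum_pc_prob_prefers[of c m 1 \<theta>]] cd one by simp
  moreover have "\<bar>real (count_sat (\<lambda>r. hd r = d \<and> prefers r 1 c) P) - s / 2\<bar> \<le> \<epsilon> * x"
    using cnt[OF sum_pc_prob_hd_prefers[of 1 m c d \<theta>]] cd one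
    by (simp add: s_def mult.commute)
  ultimately have "real (count_sat (\<lambda>r. prefers r c 1) P)
      + real (count_sat (\<lambda>r. hd r = d \<and> prefers r 1 c) P) < 2 * real (plu_score P 1)"
    using g by linarith
  then show "count_sat (\<lambda>r. prefers r c 1) P + count_sat (\<lambda>r. hd r = d \<and> prefers r 1 c) P
    < 2 * plu_score P 1" by linarith
qed

text \<open>\<open>gap1\<close> and \<open>gap2\<close> are the limits per voter of the assumptions
  \<open>plu\<close> and \<open>maj\<close> of \<open>TR_CM_if\<close>. Deviations cost 4 \<epsilon>
  and 8 \<epsilon>; the additive constants 1 and 2 there are absorbed by \<open>N\<close>, which
  gives the factors 5 and 10.\<close>

lemma TR_CM_if_typical:
  assumes m: "m \<ge> 3" and tb: "\<And>S. S \<subseteq> {1..m} \<Longrightarrow> S \<noteq> {} \<Longrightarrow> tb S \<in> S"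
    and \<theta>: "\<theta> \<le> 1"
    and P: "set P \<subseteq> rankings m" and N: "1 < \<epsilon> * real (length P)"
    and typical_P: "typical (pc_prob m \<theta>) (rankings m) \<epsilon> P" and \<epsilon>: "2 * \<epsilon> < \<theta>"
    and gap1: "5 * \<epsilon> < (1 - \<theta>) / 2 - 3 / 2 * ((1 - \<theta>) / real m) - 2 * \<theta>"
    and gap2: "10 * \<epsilon> < (1 - \<theta>) / 3 - (1 - \<theta>) / real m - \<theta>"
  shows "TR_CM tb m P"
proof -
  define x where "x = real (length P)"
  define s where "s = x * ((1 - \<theta>) / real m)"
  have P0: "P \<noteq> []" using N by auto
  have x: "x > 0" using P0 by (simp add: x_def)
  have s: "s \<ge> 0" using x \<theta> by (simp add: s_def)
  note cnt = typical_count[OF typical_P P(1), folded x_def]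
  have m2: "m \<ge> 2" using m by simp
  have in3: "1 \<in> {1..m}" "2 \<in> {1..m}" "3 \<in> {1..m}" using m by auto
  have N': "1 < \<epsilon> * x" using N by (simp add: x_def)
  have g0: "2 * (\<epsilon> * x) < x * \<theta>" using \<epsilon> x by (simp add: mult.commute)
  have g1: "5 * (\<epsilon> * x) < (x - x * \<theta>) / 2 - 3 / 2 * s - 2 * (x * \<theta>)"
    using mult_strict_left_mono[OF gap1 x] unfolding s_def by (simp add: algebra_simps diff_divide_distrib)
  have g2: "10 * (\<epsilon> * x) < (x - x * \<theta>) / 3 - s - x * \<theta>"
    using mult_strict_left_mono[OF gap2 x] unfolding s_def by (simp add: algebra_simps diff_divide_distrib)
  have c1: "\<bar>real (plu_score P 1) - (x * \<theta> + s)\<bar> \<le> \<epsilon> * x"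
    using cnt[OF sum_pc_prob_hd[OF in3(1), of \<theta>]]
    by (simp add: plu_score_count distrib_left s_def)
  have c2: "\<bar>real (count_sat (\<lambda>r. prefers r 2 1) P) - (x - x * \<theta>) / 2\<bar> \<le> \<epsilon> * x"
    using cnt[OF sum_pc_prob_prefers[of 2 m 1 \<theta>]] in3
    by (simp add: right_diff_distrib)
  have c3: "\<bar>real (count_sat (\<lambda>r. hd r = d \<and> prefers r 1 2) P) - s / 2\<bar> \<le> \<epsilon> * x"
    if "d \<in> {3..m}" for d
    using cnt[OF sum_pc_prob_hd_prefers[of 1 m 2 d \<theta>]] that in3
    by (simp add: s_def mult.commute)
  have c4: "\<bar>real (count_sat (\<lambda>r. prefers r 1 2 \<and> prefers r 2 3) P) - (x * \<theta> + (x - x * \<theta>) / 6)\<bar> \<le> \<epsilon> * x"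
    using cnt[OF sum_pc_prob_chain[of 1 m 2 3 \<theta>]] in3
    by (simp add: distrib_left right_diff_distrib)
  have c33: "\<bar>real (count_sat (\<lambda>r. hd r = 3 \<and> prefers r 1 2) P) - s / 2\<bar> \<le> \<epsilon> * x"
    using c3[of 3] m by simp
  have le: "count_sat (\<lambda>r. hd r = d \<and> prefers r 1 2) P \<le> plu_score P 1" if "d \<in> {3..m}" for d
  proof -
    have "real (count_sat (\<lambda>r. hd r = d \<and> prefers r 1 2) P) \<le> real (plu_score P 1)"
      using c3[OF that] c1 g0 s by linarith
    then show ?thesis by simp
  qed
  show ?thesis
  proof (rule TR_CM_if[OF m tb P])
    show "TR tb m P = 1" using TR_eq_1_if_typical[OF m2 tb P P0 typical_P \<epsilon>] by blast
    show "count_sat (\<lambda>r. hd r = 3 \<and> prefers r 1 2) P \<le> plu_score P 1" using le[of 3] m by simp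
    show "count_sat (\<lambda>r. hd r = e \<and> prefers r 1 2) P \<le> plu_score P 1" if "e \<in> {4..m}" for e
      using le[of e] that by simp
    have "2 * real (plu_score P 1) + 1 < real (count_sat (\<lambda>r. prefers r 2 1) P) +
        real (count_sat (\<lambda>r. hd r = 3 \<and> prefers r 1 2) P)"
      using c1 c2 c33 g1 N' by linarith
    then show "2 * plu_score P 1 + 1 < count_sat (\<lambda>r. prefers r 2 1) P +
        count_sat (\<lambda>r. hd r = 3 \<and> prefers r 1 2) P" by linarith
    have "x + 2 * real (plu_score P 1) + 2 < 2 * (real (count_sat (\<lambda>r. prefers r 1 2 \<and> prefers r 2 3) P)
        + real (count_sat (\<lambda>r. prefers r 2 1) P) + real (count_sat (\<lambda>r. hd r = 3 \<and> prefers r 1 2) P))"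
      using c1 c2 c33 c4 g2 N' by (simp add: abs_le_iff field_simps)
    then show "length P + 2 * plu_score P 1 + 2 < 2 * (count_sat (\<lambda>r. prefers r 1 2 \<and> prefers r 2 3) P
        + count_sat (\<lambda>r. prefers r 2 1) P + count_sat (\<lambda>r. hd r = 3 \<and> prefers r 1 2) P)"
      unfolding x_def distrib_left by linarith
  qed
qed

theorem theorem4p3:
  fixes tb :: "nat set \<Rightarrow> nat" and m :: nat and \<theta> :: real
  assumes "m \<ge> 3"
    and "0 < \<theta>" and "\<theta> \<le> 1"
    and "\<And>S. S \<subseteq> {1..m} \<Longrightarrow> S \<noteq> {} \<Longrightarrow> tb S \<in> S"
  shows "(\<theta> < (real m - 3) / (5 * real m - 3) \<longrightarrow> (\<lambda>n. rho_TR tb m n \<theta>) \<longlonglongrightarrow> 1)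
       \<and> (\<theta> > (real m - 3) / (5 * real m - 3) \<longrightarrow> (\<lambda>n. rho_TR tb m n \<theta>) \<longlonglongrightarrow> 0)"
proof -
  note m = assms(1) and tb = assms(4)
  have m2: "m \<ge> 2" and M: "real m \<ge> 3" using m by simp_all
  define q where "q = (1 - \<theta>) / real m"
  \<comment> \<open>The limiting surplus per voter of a coalition that lifts two candidates to the
    score of 1. By the next identity it is positive exactly below the threshold.\<close>
  define g where "g = (1 - \<theta>) / 2 - 3 / 2 * q - 2 * \<theta>"
  have g: "2 * real m * g = (real m - 3) - \<theta> * (5 * real m - 3)"
    unfolding g_def q_def using M by (simp add: field_simps)
  have w0: "0 \<le> pc_prob m \<theta> r" for r using assms(2,3) by (simp add: pc_prob_def)
  note lim = prob_tendsto_1_if_typical[OF finite_rankings w0 sum_pc_prob_rankings]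
  show ?thesis
  proof (intro conjI impI)
    assume "\<theta> < (real m - 3) / (5 * real m - 3)"
    then have "0 < 2 * real m * g" unfolding g using M by (simp add: field_simps)
    then have g0: "0 < g" using M by (simp add: zero_less_mult_iff)
    define \<epsilon> where "\<epsilon> = min \<theta> g / 30"
    have \<epsilon>: "0 < \<epsilon>" "30 * \<epsilon> \<le> \<theta>" "30 * \<epsilon> \<le> g" using g0 assms(2) by (auto simp: \<epsilon>_def)
    have gap1: "5 * \<epsilon> < (1 - \<theta>) / 2 - 3 / 2 * ((1 - \<theta>) / real m) - 2 * \<theta>"
      using \<epsilon> unfolding g_def q_def by linarith
    \<comment> \<open>The right side equals 2 g/3 + \<theta>/3, which is at least 30 \<epsilon>:
      below the threshold, winning the duel against 3 is no further obstacle.\<close>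
    have gap2: "10 * \<epsilon> < (1 - \<theta>) / 3 - (1 - \<theta>) / real m - \<theta>"
      using \<epsilon> unfolding g_def q_def by linarith
    obtain N where N: "1 / \<epsilon> < real N" using reals_Archimedean2 by blast
    have "(\<lambda>n. \<Sum>P | set P \<subseteq> rankings m \<and> length P = n.
        if TR_CM tb m P then prod_list (map (pc_prob m \<theta>) P) else 0) \<longlonglongrightarrow> 1"
    proof (rule lim[OF \<epsilon>(1)])
      fix P assume P: "set P \<subseteq> rankings m" "N < length P" "typical (pc_prob m \<theta>) (rankings m) \<epsilon> P"
      have "1 / \<epsilon> < real (length P)" using N P(2) by linarith
      then have "1 < \<epsilon> * real (length P)" using \<epsilon>(1) by (simp add: field_simps)
      then show "TR_CM tb m P"
        using TR_CM_if_typical[OF m tb assms(3) P(1) _ P(3) _ gap1 gap2] \<epsilon> by simp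
    qed
    then show "(\<lambda>n. rho_TR tb m n \<theta>) \<longlonglongrightarrow> 1" by (simp add: rho_TR_eq)
  next
    assume "\<theta> > (real m - 3) / (5 * real m - 3)"
    then have "0 < 2 * real m * (- g)" using g M by (simp add: field_simps)
    then have g0: "0 < - g" using M by (simp add: mult_less_0_iff)
    define \<epsilon> where "\<epsilon> = min \<theta> (- g) / 30"
    have \<epsilon>: "0 < \<epsilon>" "30 * \<epsilon> \<le> \<theta>" "30 * \<epsilon> \<le> - g" using g0 assms(2) by (auto simp: \<epsilon>_def)
    have gap: "4 * \<epsilon> < 2 * \<theta> + 3 / 2 * ((1 - \<theta>) / real m) - (1 - \<theta>) / 2"
      using \<epsilon> unfolding g_def q_def by linarith
    \<comment> \<open>The limit lemma only yields limits equal to 1, so it is applied to the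
      complementary event; the total mass 1 then turns this into the limit 0.\<close>
    have not_CM: "(\<lambda>n. \<Sum>P | set P \<subseteq> rankings m \<and> length P = n.
        if \<not> TR_CM tb m P then prod_list (map (pc_prob m \<theta>) P) else 0) \<longlonglongrightarrow> 1"
    proof (rule lim[OF \<epsilon>(1)])
      fix P assume P: "set P \<subseteq> rankings m" "0 < length P" "typical (pc_prob m \<theta>) (rankings m) \<epsilon> P"
      then show "\<not> TR_CM tb m P"
        using not_TR_CM_if_typical[OF m2 tb P(1) _ P(3) _ gap] \<epsilon> by simp
    qed
    have "rho_TR tb m n \<theta> = 1 - (\<Sum>P | set P \<subseteq> rankings m \<and> length P = n.
        if \<not> TR_CM tb m P then prod_list (map (pc_prob m \<theta>) P) else 0)" for n
    proof -
      have "(\<Sum>P | set P \<subseteq> rankings m \<and> length P = n. prod_list (map (pc_prob m \<theta>) P)) = 1"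
        using moments_of_count(1)[OF finite_rankings sum_pc_prob_rankings, of "{}"] by simp
      then show ?thesis unfolding rho_TR_eq
        by (simp only: eq_diff_eq flip: sum.distrib) (auto intro!: sum.cong elim!: trans[rotated])
    qed
    then show "(\<lambda>n. rho_TR tb m n \<theta>) \<longlonglongrightarrow> 0"
      using tendsto_diff[OF tendsto_const[of 1] not_CM] by simp
  qed
qed

end
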